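(* Let $B$ be planar standard Brownian motion started at the origin. (a) For every positive integer $n$ and every real $r\ge 0$, $\mathbb{P}\{|B(n)|\geq r\sqrt{n}\} = e^{-r^2/2}$. (b) $\mathbb{P}\{\sup_{0\leq t \leq n}|B(t)| \geq r\sqrt{n}\} \asymp e^{-r^2/2}$; that is, there exist constants $K>0$ and $r_0\ge 0$ such that for every positive integer $n$ and every real $r\ge r_0$, $$\frac1K e^{-r^2/2}\le \mathbb{P}\Big\{\sup_{0\leq t \leq n}|B(t)| \geq r\sqrt{n}\Big\}\le K e^{-r^2/2}.$$
   Context: $|\cdot|$ is the Euclidean norm on $\mathbb{R}^2$. The notation $f(x)\asymp g(x)$ means that there is a constant $K>0$ such that $\frac1K g(x)\le f(x)\le Kg(x)$ for all $x$ large enough. *)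

theory Defs
  imports "HOL-Probability.Probability"
begin

text \<open>
  Planar standard Brownian motion: only the times \<open>t \<ge> 0\<close> are constrained.  The density in
  \<open>normal_increments\<close> is that of the centred Gaussian law on the plane with covariance
  matrix \<open>(t - s) I\<close>.  Start at the origin and path continuity are required almost surely.
\<close>

locale planar_standard_brownian_motion = prob_space M
  for M :: "'a measure" +
  fixes B :: "real \<Rightarrow> 'a \<Rightarrow> real ^ 2"
  assumes random_variable_B: "\<And>t. 0 \<le> t \<Longrightarrow> B t \<in> borel_measurable M"
    and starts_at_origin: "AE \<omega> in M. B 0 \<omega> = 0"
    and independent_increments:
      "\<And>(k::nat) (t::nat \<Rightarrow> real). 0 \<le> t 0 \<Longrightarrow> (\<And>i. i < k \<Longrightarrow> t i \<le> t (Suc i)) \<Longrightarrow>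
         indep_vars (\<lambda>_. borel) (\<lambda>i \<omega>. B (t (Suc i)) \<omega> - B (t i) \<omega>) {..<k}"
    and normal_increments:
      "\<And>s t. 0 \<le> s \<Longrightarrow> s < t \<Longrightarrow>
         distributed M lborel (\<lambda>\<omega>. B t \<omega> - B s \<omega>)
           (\<lambda>x. ennreal (\<Prod>i\<in>UNIV. normal_density 0 (sqrt (t - s)) (x $ i)))"
    and continuous_paths: "AE \<omega> in M. continuous_on {0..} (\<lambda>t. B t \<omega>)"

text \<open>
  The event that the running maximum of \<open>|B|\<close> over \<open>[0, T]\<close> is at least \<open>c\<close>.  The
  supremum is taken in the extended reals, so it is meaningful for every path.  Since paths are
  continuous only almost surely, the event need only be measurable for the completion of \<open>M\<close>, and its
  probability is to be taken there.
\<close>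

definition running_sup_ge ::
  "'a measure \<Rightarrow> (real \<Rightarrow> 'a \<Rightarrow> real ^ 2) \<Rightarrow> real \<Rightarrow> real \<Rightarrow> 'a set" where
  "running_sup_ge M B T c =
     {\<omega> \<in> space M. (SUP t\<in>{0..T}. ereal (norm (B t \<omega>))) \<ge> ereal c}"

end

theory Submission
  imports Defs "HOL-Real_Asymp.Real_Asymp"
begin

text \<open>
  The law of \<open>|B(t)|\<close> follows from the layer-cake formula: a Gaussian radial density is the
  integral over \<open>s \<ge> |x|\<close> of its negative derivative, and after exchanging the integrals only the
  area of an annulus remains.  For the running maximum, reflecting all increments after the first
  passage time preserves the law of a walk with independent symmetric steps; since the position at
  that time is the midpoint of the original and the reflected endpoint, one of the two endpoints
  has norm at least \<open>c\<close>.  This is Levy's inequality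
  \<open>P(max |S\<^sub>k| \<ge> c) \<le> 2 P(|S\<^sub>N| \<ge> c)\<close>, which passes from dyadic times to the supremum by path
  continuity, while the lower bound is trivial.
\<close>


section \<open>Levy's maximal inequality for independent symmetric steps\<close>

text \<open>The first-passage events \<open>E k\<close> are disjoint and cover the event on the
  left. By reflection at least half the mass of each \<open>E k\<close> lies in the event
  \<open>L\<close> on the right; summing over \<open>k\<close> gives the factor 2.\<close>

lemma (in prob_space) levy_inequality:
  fixes X :: "nat \<Rightarrow> 'a \<Rightarrow> 'b::{second_countable_topology, real_normed_vector}"
  assumes indep: "indep_vars (\<lambda>_. borel) X {..<N}"
    and symm: "\<And>i. i < N \<Longrightarrow> distr M borel (\<lambda>\<omega>. - X i \<omega>) = distr M borel (X i)"
  shows "prob {\<omega> \<in> space M. \<exists>k\<le>N. c \<le> norm (\<Sum>i<k. X i \<omega>)}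
           \<le> 2 * prob {\<omega> \<in> space M. c \<le> norm (\<Sum>i<N. X i \<omega>)}"
\<comment> \<open>The empty walk is split off because the product-law criterion for independence
  below is applied to a nonempty index set.\<close>
proof (cases "N = 0")
  case True
  then show ?thesis by simp
next
  case False
  have rv[measurable]: "i < N \<Longrightarrow> X i \<in> borel_measurable M" for i
    using indep by (auto simp: indep_vars_def2)
  \<comment> \<open>A predicate on sequences rather than outcomes, so that it can be evaluated on
    original and reflected steps and read as an event of the product space.\<close>
  define first where
    "first k x \<longleftrightarrow> c \<le> norm (\<Sum>i<k. x i) \<and> (\<forall>j\<in>{..<k}. norm (\<Sum>i<j. x i) < c)"
    for k and x :: "nat \<Rightarrow> 'b"
  define E where "E k = {\<omega> \<in> space M. first k (\<lambda>i. X i \<omega>)}" for k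
  define L where "L = {\<omega> \<in> space M. c \<le> norm (\<Sum>i<N. X i \<omega>)}"
  have sum_meas: "(\<lambda>x. \<Sum>i<j. x i) \<in> borel_measurable (PiM {..<N} (\<lambda>_. borel :: 'b measure))"
    if "j \<le> N" for j
    using that by (intro borel_measurable_sum measurable_component_singleton) auto
  have sum_rv: "(\<lambda>\<omega>. \<Sum>i<j. X i \<omega>) \<in> borel_measurable M" if "j \<le> N" for j
    using that by (intro borel_measurable_sum rv) auto
  have E_sets[measurable]: "E k \<in> sets M" if "k \<le> N" for k
    unfolding E_def first_def
    using sum_rv that
    by (intro sets.sets_Collect_conj sets.sets_Collect_finite_All borel_measurable_le
          borel_measurable_less borel_measurable_norm) auto
  have L_sets[measurable]: "L \<in> sets M"
    unfolding L_def using sum_rv[of N] by measurable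
  have half: "prob (E k) \<le> 2 * prob (E k \<inter> L)" if k: "k \<le> N" for k
  proof -
    \<comment> \<open>The reflection happens at the fixed index \<open>k\<close>, not at a random
      time; first passage enters only by intersecting with \<open>E k\<close>.\<close>
    define Y where "Y i \<omega> = (if i < k then X i \<omega> else - X i \<omega>)" for i \<omega>
    have Y_rv: "i < N \<Longrightarrow> Y i \<in> borel_measurable M" for i
      unfolding Y_def by (cases "i < k") auto
    have Y_indep: "indep_vars (\<lambda>_. borel) Y {..<N}"
      using indep_vars_compose2[OF indep, of "\<lambda>i x. if i < k then x else - x" "\<lambda>_. borel"]
      by (simp add: Y_def[abs_def])
    have Y_distr: "distr M borel (Y i) = distr M borel (X i)" if "i < N" for i
      using symm[OF that] by (cases "i < k") (auto simp: Y_def[abs_def])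
    let ?P = "PiM {..<N} (\<lambda>_. borel :: 'b measure)"
    \<comment> \<open>Both joint laws are products of marginals, and symmetry makes the marginals
      agree.\<close>
    have law: "distr M ?P (\<lambda>\<omega>. \<lambda>i\<in>{..<N}. X i \<omega>) = distr M ?P (\<lambda>\<omega>. \<lambda>i\<in>{..<N}. Y i \<omega>)"
    proof -
      have "distr M ?P (\<lambda>\<omega>. \<lambda>i\<in>{..<N}. X i \<omega>) = PiM {..<N} (\<lambda>i. distr M borel (X i))"
        using indep False rv by (intro indep_vars_iff_distr_eq_PiM'[THEN iffD1]) auto
      also have "\<dots> = PiM {..<N} (\<lambda>i. distr M borel (Y i))"
        using Y_distr by (intro PiM_cong) auto
      also have "\<dots> = distr M ?P (\<lambda>\<omega>. \<lambda>i\<in>{..<N}. Y i \<omega>)"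
        using Y_indep False Y_rv
        by (intro indep_vars_iff_distr_eq_PiM'[THEN iffD1, symmetric]) auto
      finally show ?thesis .
    qed
    define A where "A = {x \<in> space ?P. first k x \<and> c \<le> norm (\<Sum>i<N. x i)}"
    have A_sets: "A \<in> sets ?P"
      unfolding A_def first_def using sum_meas k
      by (intro sets.sets_Collect_conj sets.sets_Collect_finite_All borel_measurable_le
            borel_measurable_less borel_measurable_norm) auto
    have first_restrict: "first k (\<lambda>i\<in>{..<N}. x i) = first k x" for x
      using k by (auto simp: first_def)
    \<comment> \<open>First passage at \<open>k\<close> depends only on the steps before
      \<open>k\<close>, which the reflection leaves alone.\<close>
    have first_Y: "first k (\<lambda>i. Y i \<omega>) = first k (\<lambda>i. X i \<omega>)" for \<omega>
      by (auto simp: first_def Y_def)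
    have Y_sum: "(\<Sum>i<N. Y i \<omega>) = 2 *\<^sub>R (\<Sum>i<k. X i \<omega>) - (\<Sum>i<N. X i \<omega>)" for \<omega>
    proof -
      have split: "{..<N} = {..<k} \<union> {k..<N}" using k by auto
      show ?thesis
        unfolding split
        by (subst (1 2) sum.union_disjoint) (auto simp: Y_def sum_negf scaleR_2)
    qed
    define R where "R = {\<omega> \<in> space M. c \<le> norm (\<Sum>i<N. Y i \<omega>)}"
    have R_sets[measurable]: "R \<in> sets M"
      unfolding R_def using Y_rv
      by (intro borel_measurable_le borel_measurable_norm borel_measurable_sum) auto
    have "prob (E k \<inter> L) = measure (distr M ?P (\<lambda>\<omega>. \<lambda>i\<in>{..<N}. X i \<omega>)) A"
      using A_sets rv
      by (subst measure_distr)
         (auto simp: A_def E_def L_def first_restrict space_PiM cong del: image_cong_simp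
            intro!: arg_cong[where f=prob] measurable_restrict)
    also have "\<dots> = prob (E k \<inter> R)"
      unfolding law using A_sets Y_rv
      by (subst measure_distr)
         (auto simp: A_def E_def R_def first_restrict first_Y space_PiM
            intro!: arg_cong[where f=prob] measurable_restrict)
    finally have eq: "prob (E k \<inter> R) = prob (E k \<inter> L)" ..
    \<comment> \<open>The sum at \<open>k\<close> is the midpoint of the two endpoints, so on
      \<open>E k\<close> they cannot both have norm below \<open>c\<close>.\<close>
    have "E k \<subseteq> (E k \<inter> L) \<union> (E k \<inter> R)"
    proof
      fix \<omega> assume w: "\<omega> \<in> E k"
      let ?S = "\<Sum>i<k. X i \<omega>" and ?T = "\<Sum>i<N. X i \<omega>"
      have "2 * norm ?S = norm (?T + (2 *\<^sub>R ?S - ?T))" by simp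
      also have "\<dots> \<le> norm ?T + norm (2 *\<^sub>R ?S - ?T)" by (rule norm_triangle_ineq)
      finally show "\<omega> \<in> (E k \<inter> L) \<union> (E k \<inter> R)"
        using w by (auto simp: E_def L_def R_def first_def Y_sum)
    qed
    then have "prob (E k) \<le> prob ((E k \<inter> L) \<union> (E k \<inter> R))"
      using k by (intro finite_measure_mono) auto
    also have "\<dots> \<le> prob (E k \<inter> L) + prob (E k \<inter> R)"
      using k by (intro measure_subadditive) auto
    finally show ?thesis using eq by simp
  qed
  have disj: "disjoint_family_on E {..N}"
  proof (unfold disjoint_family_on_def, intro ballI impI)
    fix i j :: nat assume "i \<noteq> j"
    moreover have False if "a < b" "\<omega> \<in> E a" "\<omega> \<in> E b" for a b \<omega>
      using that by (auto simp: E_def first_def not_less[symmetric])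
    ultimately show "E i \<inter> E j = {}"
      by (meson disjoint_iff linorder_neqE_nat)
  qed
  have "{\<omega> \<in> space M. \<exists>k\<le>N. c \<le> norm (\<Sum>i<k. X i \<omega>)} \<subseteq> (\<Union>k\<le>N. E k)"
  proof safe
    fix \<omega> k assume w: "\<omega> \<in> space M" and k: "k \<le> N" "c \<le> norm (\<Sum>i<k. X i \<omega>)"
    define m where "m = (LEAST k. c \<le> norm (\<Sum>i<k. X i \<omega>))"
    have "m \<le> k" "c \<le> norm (\<Sum>i<m. X i \<omega>)"
      unfolding m_def by (rule Least_le, fact) (rule LeastI, fact)
    moreover have "norm (\<Sum>i<j. X i \<omega>) < c" if "j < m" for j
      using not_less_Least[OF that[unfolded m_def]] by simp
    ultimately show "\<omega> \<in> (\<Union>k\<le>N. E k)"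
      using w k by (auto simp: E_def first_def intro!: bexI[of _ m])
  qed
  then have "prob {\<omega> \<in> space M. \<exists>k\<le>N. c \<le> norm (\<Sum>i<k. X i \<omega>)} \<le> prob (\<Union>k\<le>N. E k)"
    by (intro finite_measure_mono) auto
  also have "\<dots> = (\<Sum>k\<le>N. prob (E k))"
    using disj by (intro finite_measure_finite_Union) auto
  also have "\<dots> \<le> (\<Sum>k\<le>N. 2 * prob (E k \<inter> L))"
    by (intro sum_mono half) auto
  also have "\<dots> = 2 * (\<Sum>k\<le>N. prob (E k \<inter> L))"
    by (simp add: sum_distrib_left)
  also have "(\<Sum>k\<le>N. prob (E k \<inter> L)) = prob (\<Union>k\<le>N. E k \<inter> L)"
    using disj by (intro finite_measure_finite_Union[symmetric]) (auto simp: disjoint_family_on_def)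
  also have "2 * \<dots> \<le> 2 * prob L"
    by (intro mult_left_mono finite_measure_mono) auto
  finally show ?thesis by (simp add: L_def)
qed

section \<open>Tail of the norm under the planar Gaussian law\<close>

lemma planar_normal_density_radial:
  fixes x :: "real ^ 2"
  assumes "v > 0"
  shows "(\<Prod>i\<in>UNIV. normal_density 0 (sqrt v) (x $ i)) = exp (- (norm x)\<^sup>2 / (2 * v)) / (2 * pi * v)"
proof -
  have "(norm x)\<^sup>2 = (x $ 1)\<^sup>2 + (x $ 2)\<^sup>2"
    by (simp add: norm_vec_def L2_set_def UNIV_2)
  then have "exp (- (norm x)\<^sup>2 / (2 * v)) = exp (- (x $ 1)\<^sup>2 / (2 * v)) * exp (- (x $ 2)\<^sup>2 / (2 * v))"
    by (simp add: exp_add[symmetric] diff_divide_distrib)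
  moreover have "sqrt (2 * pi * v) * sqrt (2 * pi * v) = 2 * pi * v"
    using assms by simp
  ultimately show ?thesis
    using assms by (simp add: UNIV_2 normal_density_def)
qed

text \<open>A closed disc minus an open one, both of finite area. This is the inner integral that
  remains once the layer-cake integrals are exchanged.\<close>

lemma emeasure_lborel_annulus:
  fixes c s :: real
  assumes "0 \<le> c" "c \<le> s"
  shows "emeasure lborel {x :: real ^ 2. c \<le> norm x \<and> norm x \<le> s} = ennreal (pi * (s\<^sup>2 - c\<^sup>2))"
proof -
  have "{x :: real ^ 2. c \<le> norm x \<and> norm x \<le> s} = cball 0 s - ball 0 c"
    by auto
  also have "emeasure lborel \<dots> = emeasure lborel (cball (0::real^2) s) - emeasure lborel (ball (0::real^2) c)"
    using assms by (intro emeasure_Diff) (auto simp: emeasure_ball)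
  also have "\<dots> = ennreal (pi * s\<^sup>2) - ennreal (pi * c\<^sup>2)"
    using assms by (simp add: emeasure_ball emeasure_cball unit_ball_vol_2 )
  also have "\<dots> = ennreal (pi * (s\<^sup>2 - c\<^sup>2))"
    by (subst ennreal_minus) (auto simp: algebra_simps)
  finally show ?thesis .
qed

text \<open>The integrand is the derivative of \<open>- exp (- s\<^sup>2 / (2 * v))\<close>, which
  vanishes at infinity. Read from right to left, this is the layer-cake representation of the radial
  factor.\<close>

lemma nn_integral_gaussian_tail:
  fixes a v :: real
  assumes "0 \<le> a" "v > 0"
  shows "(\<integral>\<^sup>+s. ennreal (s / v * exp (- s\<^sup>2 / (2 * v))) * indicator {a..} s \<partial>lborel)
           = ennreal (exp (- a\<^sup>2 / (2 * v)))"
proof -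
  have "((\<lambda>s. - exp (- s\<^sup>2 / (2 * v))) \<longlongrightarrow> 0) at_top"
    using assms(2) by real_asymp
  then have "(\<integral>\<^sup>+s. ennreal (s / v * exp (- s\<^sup>2 / (2 * v))) * indicator {a..} s \<partial>lborel)
      = ennreal (0 - - exp (- a\<^sup>2 / (2 * v)))"
    using assms
    by (intro nn_integral_FTC_atLeast) (auto intro!: derivative_eq_intros simp: field_simps)
  then show ?thesis by simp
qed

text \<open>Exchanging the integrals in the layer-cake representation takes the place of polar
  coordinates: only a one-dimensional integral against the annulus area remains, and it has an
  explicit antiderivative.\<close>

lemma nn_integral_planar_gaussian_tail:
  fixes c v :: real
  assumes c: "0 \<le> c" and v: "v > 0"
  shows "(\<integral>\<^sup>+x. ennreal (\<Prod>i\<in>UNIV. normal_density 0 (sqrt v) ((x::real^2) $ i))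
             * indicator {x. c \<le> norm x} x \<partial>lborel)
           = ennreal (exp (- c\<^sup>2 / (2 * v)))"
proof -
  define h where "h s = s / v * exp (- s\<^sup>2 / (2 * v))" for s
  have h_meas[measurable]: "h \<in> borel_measurable borel" unfolding h_def by measurable
  \<comment> \<open>One kernel serves both orders of integration: for fixed \<open>x\<close> it cuts
    \<open>s\<close> to the tail from \<open>norm x\<close>, for fixed \<open>s\<close> it cuts
    \<open>x\<close> to an annulus.\<close>
  let ?I = "\<lambda>x::real^2. \<lambda>s::real. indicator {x. c \<le> norm x \<and> norm x \<le> s} x :: ennreal"
  have I_meas: "(\<lambda>(x::real^2, s). ennreal (h s) * ?I x s) \<in> borel_measurable (lborel \<Otimes>\<^sub>M lborel)"
    by (simp add: indicator_def[abs_def]) measurable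
  have tail: "(\<integral>\<^sup>+s. ennreal (h s) * ?I x s \<partial>lborel)
        = ennreal (exp (- (norm x)\<^sup>2 / (2 * v))) * indicator {x. c \<le> norm x} x" for x :: "real^2"
  proof -
    have "(\<integral>\<^sup>+s. ennreal (h s) * ?I x s \<partial>lborel)
        = (\<integral>\<^sup>+s. (ennreal (h s) * indicator {norm x..} s) * indicator {x. c \<le> norm x} x \<partial>lborel)"
      by (intro nn_integral_cong) (auto simp: indicator_def)
    also have "\<dots> = (\<integral>\<^sup>+s. ennreal (h s) * indicator {norm x..} s \<partial>lborel) * indicator {x. c \<le> norm x} x"
      by (rule nn_integral_multc) measurable
    finally show ?thesis
      unfolding h_def using nn_integral_gaussian_tail[of "norm x" v] v by simp
  qed
  \<comment> \<open>The antiderivative of \<open>h s * (pi * (s\<^sup>2 - c\<^sup>2))\<close> found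
    by integration by parts; the summand \<open>2 * v\<close> comes from integrating
    \<open>2 * pi * s * exp (- s\<^sup>2 / (2 * v))\<close>.\<close>
  have lim: "((\<lambda>s. - (s\<^sup>2 - c\<^sup>2 + 2 * v) * pi * exp (- s\<^sup>2 / (2 * v))) \<longlongrightarrow> 0) at_top"
    using v by real_asymp
  have "(\<integral>\<^sup>+x. ennreal (exp (- (norm x)\<^sup>2 / (2 * v))) * indicator {x. c \<le> norm x} (x::real^2) \<partial>lborel)
      = (\<integral>\<^sup>+x. (\<integral>\<^sup>+s. ennreal (h s) * ?I x s \<partial>lborel) \<partial>lborel)"
    by (simp add: tail)
  also have "\<dots> = (\<integral>\<^sup>+s. (\<integral>\<^sup>+x. ennreal (h s) * ?I x s \<partial>lborel) \<partial>lborel)"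
    by (rule lborel_pair.Fubini'[OF I_meas, symmetric])
  also have "\<dots> = (\<integral>\<^sup>+s. ennreal (h s * (pi * (s\<^sup>2 - c\<^sup>2))) * indicator {c..} s \<partial>lborel)"
  proof (intro nn_integral_cong)
    fix s :: real
    have *: "(\<integral>\<^sup>+x. ennreal (h s) * ?I x s \<partial>lborel)
        = ennreal (h s) * emeasure lborel {x :: real ^ 2. c \<le> norm x \<and> norm x \<le> s}"
      by (subst nn_integral_cmult_indicator) auto
    show "(\<integral>\<^sup>+x. ennreal (h s) * ?I x s \<partial>lborel)
        = ennreal (h s * (pi * (s\<^sup>2 - c\<^sup>2))) * indicator {c..} s"
    proof (cases "c \<le> s")
      case True
      moreover have "0 \<le> s\<^sup>2 - c\<^sup>2" using True c by simp
      ultimately show ?thesis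
        unfolding * by (simp add: emeasure_lborel_annulus c ennreal_mult'')
    next
      case False
      then have "{x :: real ^ 2. c \<le> norm x \<and> norm x \<le> s} = {}" by auto
      with False show ?thesis unfolding * by (simp only: emeasure_empty) simp
    qed
  qed
  also have "\<dots> = ennreal (0 - - (c\<^sup>2 - c\<^sup>2 + 2 * v) * pi * exp (- c\<^sup>2 / (2 * v)))"
  proof (rule nn_integral_FTC_atLeast[OF _ _ _ lim])
    fix s assume "c \<le> s"
    then show "0 \<le> h s * (pi * (s\<^sup>2 - c\<^sup>2))" using c v by (auto simp: h_def)
    show "((\<lambda>s. - (s\<^sup>2 - c\<^sup>2 + 2 * v) * pi * exp (- s\<^sup>2 / (2 * v))) has_real_derivative
        h s * (pi * (s\<^sup>2 - c\<^sup>2))) (at s)"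
      using v by (auto intro!: derivative_eq_intros simp: h_def field_simps power2_eq_square)
  qed measurable
  finally have main: "(\<integral>\<^sup>+x. ennreal (exp (- (norm x)\<^sup>2 / (2 * v))) * indicator {x. c \<le> norm x} (x::real^2) \<partial>lborel)
      = ennreal (2 * pi * v * exp (- c\<^sup>2 / (2 * v)))"
    by (simp add: mult_ac)
  have "(\<integral>\<^sup>+x. ennreal (\<Prod>i\<in>UNIV. normal_density 0 (sqrt v) ((x::real^2) $ i))
             * indicator {x. c \<le> norm x} x \<partial>lborel)
      = (\<integral>\<^sup>+x. ennreal (1 / (2 * pi * v)) *
          (ennreal (exp (- (norm x)\<^sup>2 / (2 * v))) * indicator {x. c \<le> norm x} (x::real^2)) \<partial>lborel)"
    using v by (intro nn_integral_cong)
      (simp add: planar_normal_density_radial ennreal_mult'[symmetric] mult.assoc[symmetric])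
  also have "\<dots> = ennreal (1 / (2 * pi * v)) * ennreal (2 * pi * v * exp (- c\<^sup>2 / (2 * v)))"
    unfolding main[symmetric] by (rule nn_integral_cmult) measurable
  also have "\<dots> = ennreal (exp (- c\<^sup>2 / (2 * v)))"
    using v by (simp add: ennreal_mult'[symmetric])
  finally show ?thesis .
qed

section \<open>Law of the norm and maxima over dyadic times\<close>

context planar_standard_brownian_motion
begin

text \<open>Since \<open>B 0\<close> vanishes almost surely, \<open>B t\<close> may be replaced by
  the increment from time 0, whose density is given.\<close>

lemma prob_norm_ge:
  assumes c: "0 \<le> c" and t: "0 < t"
  shows "prob {\<omega> \<in> space M. c \<le> norm (B t \<omega>)} = exp (- c\<^sup>2 / (2 * t))"
proof -
  have [measurable]: "B t \<in> borel_measurable M" "B 0 \<in> borel_measurable M"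
    using t by (auto intro: random_variable_B)
  have "prob {\<omega> \<in> space M. c \<le> norm (B t \<omega>)} = prob {\<omega> \<in> space M. c \<le> norm (B t \<omega> - B 0 \<omega>)}"
    using starts_at_origin by (intro measure_eq_AE) auto
  moreover have "emeasure M ((\<lambda>\<omega>. B t \<omega> - B 0 \<omega>) -` {x. c \<le> norm x} \<inter> space M)
      = ennreal (exp (- c\<^sup>2 / (2 * t)))"
    using nn_integral_planar_gaussian_tail[OF c t] t
    by (subst distributed_emeasure[OF normal_increments]) auto
  moreover have "(\<lambda>\<omega>. B t \<omega> - B 0 \<omega>) -` {x. c \<le> norm x} \<inter> space M
      = {\<omega> \<in> space M. c \<le> norm (B t \<omega> - B 0 \<omega>)}"
    by auto
  ultimately show ?thesis
    by (simp add: measure_def)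
qed

text \<open>The Gaussian density is even and Lebesgue measure is invariant under negation. This
  supplies the symmetry hypothesis of \<open>levy_inequality\<close>.\<close>

lemma increment_symmetric:
  assumes "0 \<le> s" "s < t"
  shows "distr M borel (\<lambda>\<omega>. - (B t \<omega> - B s \<omega>)) = distr M borel (\<lambda>\<omega>. B t \<omega> - B s \<omega>)"
proof (rule measure_eqI)
  let ?D = "\<lambda>\<omega>. B t \<omega> - B s \<omega>"
  let ?f = "\<lambda>x::real^2. ennreal (\<Prod>i\<in>UNIV. normal_density 0 (sqrt (t - s)) (x $ i))"
  have [measurable]: "B t \<in> borel_measurable M" "B s \<in> borel_measurable M"
    using assms by (auto intro: random_variable_B)
  have f_meas[measurable]: "?f \<in> borel_measurable borel"
    using normal_increments[OF assms] by (simp add: distributed_def)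
  have f_even: "?f (- x) = ?f x" for x
    by (simp add: normal_density_def)
  have lborel_uminus: "(lborel :: (real^2) measure) = distr lborel borel uminus"
    using lborel_affine[of "-1" "0 :: real^2"] by (simp add: density_1)
  fix A assume "A \<in> sets (distr M borel (\<lambda>\<omega>. - ?D \<omega>))"
  then have A[measurable]: "A \<in> sets borel" by simp
  have "emeasure (distr M borel (\<lambda>\<omega>. - ?D \<omega>)) A = emeasure M (?D -` (uminus -` A) \<inter> space M)"
    by (subst emeasure_distr) (auto intro!: arg_cong[where f="emeasure M"])
  also have "\<dots> = (\<integral>\<^sup>+x. ?f x * indicator (uminus -` A) x \<partial>lborel)"
    using measurable_sets[OF borel_measurable_uminus[OF measurable_ident_sets[OF refl]] A]
    by (intro distributed_emeasure[OF normal_increments[OF assms]]) (simp add: vimage_def)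
  also have "\<dots> = (\<integral>\<^sup>+x. ?f (- x) * indicator A (- x) \<partial>lborel)"
    unfolding f_even by (simp add: indicator_def)
  also have "\<dots> = (\<integral>\<^sup>+x. ?f x * indicator A x \<partial>distr lborel borel uminus)"
    by (subst nn_integral_distr) auto
  also have "\<dots> = (\<integral>\<^sup>+x. ?f x * indicator A x \<partial>lborel)"
    unfolding lborel_uminus[symmetric] ..
  also have "\<dots> = emeasure M (?D -` A \<inter> space M)"
    by (rule distributed_emeasure[OF normal_increments[OF assms], symmetric]) simp
  also have "\<dots> = emeasure (distr M borel ?D) A"
    by (subst emeasure_distr) auto
  finally show "emeasure (distr M borel (\<lambda>\<omega>. - ?D \<omega>)) A = emeasure (distr M borel ?D) A" .
qed simp

text \<open>Levy's inequality for the \<open>2 ^ m\<close> increments over a uniform grid, whose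
  partial sums telescope to \<open>B (t k) - B 0\<close>. Every grid ends at \<open>T\<close>, so
  the bound does not depend on \<open>m\<close>.\<close>

lemma prob_dyadic_max_ge:
  assumes T: "0 < T"
  shows "prob {\<omega> \<in> space M. \<exists>k\<le>2 ^ m. c \<le> norm (B (T * real k / 2 ^ m) \<omega>)}
           \<le> 2 * prob {\<omega> \<in> space M. c \<le> norm (B T \<omega>)}"
proof -
  define t where "t k = T * real k / 2 ^ m" for k :: nat
  have t_less: "0 \<le> t i" "t i < t (Suc i)" for i
    using T by (auto simp: t_def field_simps)
  have t_ends: "t 0 = 0" "t (2 ^ m) = T"
    by (auto simp: t_def)
  have [measurable]: "B (t k) \<in> borel_measurable M" for k
    using t_less(1) by (rule random_variable_B)
  have telescope: "(\<Sum>i<k. B (t (Suc i)) \<omega> - B (t i) \<omega>) = B (t k) \<omega> - B 0 \<omega>" for k \<omega>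
    by (subst sum_lessThan_telescope) (simp add: t_ends)
  have [measurable]: "B 0 \<in> borel_measurable M" "B T \<in> borel_measurable M"
    using T by (auto intro: random_variable_B)
  have "prob {\<omega> \<in> space M. \<exists>k\<le>2 ^ m. c \<le> norm (B (t k) \<omega>)}
      = prob {\<omega> \<in> space M. \<exists>k\<le>2 ^ m. c \<le> norm (B (t k) \<omega> - B 0 \<omega>)}"
    using starts_at_origin by (intro measure_eq_AE) auto
  also have "\<dots> \<le> 2 * prob {\<omega> \<in> space M. c \<le> norm (B (t (2 ^ m)) \<omega> - B 0 \<omega>)}"
    using levy_inequality[OF independent_increments[of t "2 ^ m"]
        increment_symmetric[OF t_less], of c]
      t_less by (simp only: telescope less_imp_le)
  also have "prob {\<omega> \<in> space M. c \<le> norm (B (t (2 ^ m)) \<omega> - B 0 \<omega>)}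
      = prob {\<omega> \<in> space M. c \<le> norm (B T \<omega>)}"
    unfolding t_ends using starts_at_origin by (intro measure_eq_AE) auto
  finally show ?thesis by (simp add: t_def)
qed

section \<open>From dyadic times to the running supremum\<close>

text \<open>Only countably many times occur, so the event lies in \<open>sets M\<close> itself and
  not merely in the completion.\<close>

definition dyadic_exceeds :: "real \<Rightarrow> real \<Rightarrow> 'a set" where
  "dyadic_exceeds T c = {\<omega> \<in> space M. \<exists>m. \<exists>k\<le>2 ^ m. c \<le> norm (B (T * real k / 2 ^ m) \<omega>)}"

lemma sets_dyadic_exceeds:
  assumes "0 < T"
  shows "dyadic_exceeds T c \<in> sets M"
proof -
  have [measurable]: "B (T * real k / 2 ^ m) \<in> borel_measurable M" for k m
    using assms by (intro random_variable_B) auto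
  show ?thesis unfolding dyadic_exceeds_def by measurable
qed

text \<open>The grids are nested, index \<open>k\<close> at level \<open>m\<close> being
  \<open>2 * k\<close> at the next, so the events increase with \<open>m\<close>; continuity from
  below carries the uniform bound to their union.\<close>

lemma prob_dyadic_exceeds_le:
  assumes T: "0 < T"
  shows "prob (dyadic_exceeds T c) \<le> 2 * prob {\<omega> \<in> space M. c \<le> norm (B T \<omega>)}"
proof -
  define F where "F m = {\<omega> \<in> space M. \<exists>k\<le>2 ^ m. c \<le> norm (B (T * real k / 2 ^ m) \<omega>)}" for m :: nat
  have [measurable]: "B (T * real k / 2 ^ m) \<in> borel_measurable M" for k m
    using T by (intro random_variable_B) auto
  have F_sets: "range F \<subseteq> sets M"
    unfolding F_def by auto
  have "F m \<subseteq> F (Suc m)" for m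
  proof
    fix \<omega> assume "\<omega> \<in> F m"
    then obtain k where k: "\<omega> \<in> space M" "k \<le> 2 ^ m" "c \<le> norm (B (T * real k / 2 ^ m) \<omega>)"
      by (auto simp: F_def)
    have "T * real k / 2 ^ m = T * real (2 * k) / 2 ^ Suc m" by simp
    with k(3) have "c \<le> norm (B (T * real (2 * k) / 2 ^ Suc m) \<omega>)" by (simp only:)
    moreover have "2 * k \<le> 2 ^ Suc m" using k(2) by simp
    ultimately show "\<omega> \<in> F (Suc m)"
      using k(1) unfolding F_def by blast
  qed
  then have "incseq F" by (rule incseq_SucI)
  then have "(\<lambda>m. prob (F m)) \<longlonglongrightarrow> prob (\<Union>m. F m)"
    by (rule finite_Lim_measure_incseq[OF F_sets])
  moreover have "(\<Union>m. F m) = dyadic_exceeds T c"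
    by (auto simp: F_def dyadic_exceeds_def)
  moreover have "prob (F m) \<le> 2 * prob {\<omega> \<in> space M. c \<le> norm (B T \<omega>)}" for m
    unfolding F_def by (rule prob_dyadic_max_ge[OF T])
  ultimately show ?thesis
    by (intro LIMSEQ_le_const2[of "\<lambda>m. prob (F m)"]) auto
qed

text \<open>The slack \<open>1 / real (Suc j)\<close> is essential: the level \<open>c\<close> may
  be attained only at a non-dyadic time, and dyadic times then merely come arbitrarily close to
  it.\<close>

lemma running_sup_ge_iff_dyadic:
  assumes T: "0 < T" and w: "\<omega> \<in> space M" and cont: "continuous_on {0..} (\<lambda>t. B t \<omega>)"
  shows "\<omega> \<in> running_sup_ge M B T c \<longleftrightarrow> (\<forall>j. \<omega> \<in> dyadic_exceeds T (c - 1 / real (Suc j)))"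
proof
  assume sup: "\<omega> \<in> running_sup_ge M B T c"
  show "\<forall>j. \<omega> \<in> dyadic_exceeds T (c - 1 / real (Suc j))"
  proof
    fix j
    define d where "d = c - 1 / real (Suc j)"
    have "ereal d < ereal c" by (simp add: d_def)
    also have "\<dots> \<le> (SUP t\<in>{0..T}. ereal (norm (B t \<omega>)))"
      using sup by (simp add: running_sup_ge_def)
    finally obtain t where t: "0 \<le> t" "t \<le> T" "d < norm (B t \<omega>)"
      by (auto simp: less_SUP_iff)
    \<comment> \<open>Rounding down to the grid gives a point of \<open>{0..T}\<close> at most
      \<open>T / 2 ^ m\<close> below \<open>t\<close>, so path continuity applies along these
      points.\<close>
    define k where "k m = nat \<lfloor>2 ^ m * (t / T)\<rfloor>" for m
    have q: "0 \<le> 2 ^ m * (t / T)" "2 ^ m * (t / T) \<le> 2 ^ m" for m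
      using t T by (auto simp: field_simps)
    have k_eq: "real (k m) = of_int \<lfloor>2 ^ m * (t / T)\<rfloor>" for m
      using q(1)[of m] by (simp add: k_def)
    have k_le: "k m \<le> 2 ^ m" for m
    proof -
      have "real (k m) \<le> 2 ^ m" unfolding k_eq using q(2)[of m] by linarith
      then show ?thesis by simp
    qed
    have "(\<lambda>m. T * real (k m) / 2 ^ m) \<longlonglongrightarrow> t"
    proof (rule tendsto_sandwich)
      have le: "2 ^ m * (t / T) - 1 \<le> real (k m)" "real (k m) \<le> 2 ^ m * (t / T)" for m
        unfolding k_eq by linarith+
      show "\<forall>\<^sub>F m in sequentially. t - T / 2 ^ m \<le> T * real (k m) / 2 ^ m"
      proof (intro always_eventually allI)
        fix m
        have "t - T / 2 ^ m = T * (2 ^ m * (t / T) - 1) / 2 ^ m"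
          using T by (simp add: field_simps)
        also have "\<dots> \<le> T * real (k m) / 2 ^ m"
          using le(1)[of m] T by (intro divide_right_mono mult_left_mono) auto
        finally show "t - T / 2 ^ m \<le> T * real (k m) / 2 ^ m" .
      qed
      show "\<forall>\<^sub>F m in sequentially. T * real (k m) / 2 ^ m \<le> t"
        using le(2) T by (intro always_eventually allI) (simp add: field_simps)
      have "(\<lambda>m. t - T / 2 ^ m) \<longlonglongrightarrow> t - 0"
        by (intro tendsto_diff tendsto_const LIMSEQ_divide_realpow_zero) simp
      then show "(\<lambda>m. t - T / 2 ^ m) \<longlonglongrightarrow> t" by simp
    qed simp
    then have "(\<lambda>m. B (T * real (k m) / 2 ^ m) \<omega>) \<longlonglongrightarrow> B t \<omega>"
      using T t by (intro continuous_on_tendsto_compose[OF cont]) auto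
    then have "(\<lambda>m. norm (B (T * real (k m) / 2 ^ m) \<omega>)) \<longlonglongrightarrow> norm (B t \<omega>)"
      by (rule tendsto_norm)
    then have "\<forall>\<^sub>F m in sequentially. d < norm (B (T * real (k m) / 2 ^ m) \<omega>)"
      using t(3) by (rule order_tendstoD)
    then obtain m where "d \<le> norm (B (T * real (k m) / 2 ^ m) \<omega>)"
      by (auto simp: eventually_sequentially intro: less_imp_le)
    with k_le[of m] w show "\<omega> \<in> dyadic_exceeds T (c - 1 / real (Suc j))"
      unfolding dyadic_exceeds_def d_def[symmetric] by blast
  qed
next
  assume ex: "\<forall>j. \<omega> \<in> dyadic_exceeds T (c - 1 / real (Suc j))"
  let ?S = "SUP t\<in>{0..T}. ereal (norm (B t \<omega>))"
  have "ereal (c - 1 / real (Suc j)) \<le> ?S" for j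
  proof -
    obtain m k :: nat where "k \<le> 2 ^ m" and le: "c - 1 / real (Suc j) \<le> norm (B (T * real k / 2 ^ m) \<omega>)"
      using ex[rule_format, of j] unfolding dyadic_exceeds_def by blast
    then have "real k \<le> 2 ^ m" by simp
    then have "T * real k / 2 ^ m \<in> {0..T}"
      using T by (simp add: field_simps)
    then have "ereal (norm (B (T * real k / 2 ^ m) \<omega>)) \<le> ?S" by (rule SUP_upper)
    with le show ?thesis by (meson ereal_less_eq(3) order_trans)
  qed
  moreover have "(\<lambda>j. ereal (c - 1 / real (Suc j))) \<longlonglongrightarrow> ereal (c - 0)"
    unfolding lim_ereal by (intro tendsto_diff tendsto_const LIMSEQ_Suc[OF lim_1_over_n])
  ultimately have "ereal c \<le> ?S"
    by (intro LIMSEQ_le_const2[of "\<lambda>j. ereal (c - 1 / real (Suc j))"]) auto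
  with w show "\<omega> \<in> running_sup_ge M B T c" by (simp add: running_sup_ge_def)
qed

text \<open>On continuous paths the event is a countable intersection of events of \<open>M\<close>.
  Discontinuous paths form a null set, which the completion absorbs.\<close>

lemma measure_running_sup_ge:
  assumes T: "0 < T"
  shows "measure (completion M) (running_sup_ge M B T c)
           = prob (\<Inter>j. dyadic_exceeds T (c - 1 / real (Suc j)))" (is "_ = prob ?E")
    and "running_sup_ge M B T c \<in> sets (completion M)"
proof -
  have E: "?E \<in> sets M" using sets_dyadic_exceeds[OF T] by auto
  have ae: "AE \<omega> in completion M. \<omega> \<in> ?E \<longleftrightarrow> \<omega> \<in> running_sup_ge M B T c"
    using continuous_paths AE_space
    by (intro AE_completion, eventually_elim) (simp add: running_sup_ge_iff_dyadic[OF T])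
  show R: "running_sup_ge M B T c \<in> sets (completion M)"
    by (rule completion.in_sets_AE[OF ae sets_completionI_sets[OF E]])
       (auto simp: running_sup_ge_def)
  have "measure (completion M) (running_sup_ge M B T c) = measure (completion M) ?E"
    using ae E R by (intro measure_eq_AE) auto
  also have "\<dots> = prob ?E"
    using E by simp
  finally show "measure (completion M) (running_sup_ge M B T c) = prob ?E" .
qed

text \<open>For each \<open>j\<close> the dyadic bound holds at level
  \<open>c - 1 / real (Suc j)\<close>. The endpoint events decrease to the one at level
  \<open>c\<close>, so continuity from above removes the slack.\<close>

lemma prob_running_sup_ge_le:
  assumes T: "0 < T"
  shows "measure (completion M) (running_sup_ge M B T c)
           \<le> 2 * prob {\<omega> \<in> space M. c \<le> norm (B T \<omega>)}"
proof -
  have [measurable]: "B T \<in> borel_measurable M" using T by (intro random_variable_B) simp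
  define A where "A j = {\<omega> \<in> space M. c - 1 / real (Suc j) \<le> norm (B T \<omega>)}" for j
  have dec: "decseq A"
    unfolding decseq_def A_def
    by (auto intro: order_trans[rotated] simp: frac_le)
  have "(\<Inter>j. A j) = {\<omega> \<in> space M. c \<le> norm (B T \<omega>)}"
  proof -
    have "c \<le> x" if "\<And>j. c - 1 / real (Suc j) \<le> x" for x
    proof -
      have "(\<lambda>j. c - 1 / real (Suc j)) \<longlonglongrightarrow> c - 0"
        by (intro tendsto_diff tendsto_const LIMSEQ_Suc[OF lim_1_over_n])
      then show ?thesis using that by (intro LIMSEQ_le_const2) auto
    qed
    moreover have "c - 1 / real (Suc j) \<le> x" if "c \<le> x" for x j
      using that by (smt (verit) of_nat_0_le_iff zero_le_divide_1_iff)
    ultimately show ?thesis by (auto simp: A_def simp del: of_nat_Suc)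
  qed
  moreover have "(\<lambda>j. prob (A j)) \<longlonglongrightarrow> prob (\<Inter>j. A j)"
    by (rule finite_Lim_measure_decseq[OF _ dec]) (auto simp: A_def)
  ultimately have "(\<lambda>j. 2 * prob (A j)) \<longlonglongrightarrow> 2 * prob {\<omega> \<in> space M. c \<le> norm (B T \<omega>)}"
    by (auto intro: tendsto_mult_left)
  moreover have "measure (completion M) (running_sup_ge M B T c) \<le> 2 * prob (A j)" for j
  proof -
    have "measure (completion M) (running_sup_ge M B T c)
        \<le> prob (dyadic_exceeds T (c - 1 / real (Suc j)))"
      unfolding measure_running_sup_ge(1)[OF T]
      using sets_dyadic_exceeds[OF T] by (intro finite_measure_mono) auto
    also have "\<dots> \<le> 2 * prob (A j)"
      unfolding A_def by (rule prob_dyadic_exceeds_le[OF T])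
    finally show ?thesis .
  qed
  ultimately show ?thesis
    by (intro LIMSEQ_le_const[of "\<lambda>j. 2 * prob (A j)"]) auto
qed

text \<open>The time \<open>T\<close> itself takes part in the supremum, and the completion agrees
  with \<open>M\<close> on measurable events.\<close>

lemma prob_running_sup_ge_ge:
  assumes T: "0 < T"
  shows "prob {\<omega> \<in> space M. c \<le> norm (B T \<omega>)} \<le> measure (completion M) (running_sup_ge M B T c)"
proof -
  interpret completion: finite_measure "completion M"
    by (rule finite_measureI) (simp add: emeasure_space_1)
  have [measurable]: "B T \<in> borel_measurable M" using T by (intro random_variable_B) simp
  have "{\<omega> \<in> space M. c \<le> norm (B T \<omega>)} \<subseteq> running_sup_ge M B T c"
    using T by (auto simp: running_sup_ge_def intro!: SUP_upper2[of T])
  then have "measure (completion M) {\<omega> \<in> space M. c \<le> norm (B T \<omega>)}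
      \<le> measure (completion M) (running_sup_ge M B T c)"
    by (intro completion.finite_measure_mono measure_running_sup_ge(2)[OF T])
  then show ?thesis by simp
qed

end

section \<open>Exact tail and two-sided bound at integer times\<close>

theorem lemma3p3:
  fixes M :: "'a measure" and B :: "real \<Rightarrow> 'a \<Rightarrow> real ^ 2"
  assumes "planar_standard_brownian_motion M B"
  shows
    "(\<forall>(n::nat) (r::real). n \<ge> 1 \<longrightarrow> r \<ge> 0 \<longrightarrow>
        measure M {\<omega> \<in> space M. norm (B (real n) \<omega>) \<ge> r * sqrt (real n)} = exp (- (r\<^sup>2) / 2))
     \<and>
     (\<exists>(K::real) (r0::real). K > 0 \<and> r0 \<ge> 0 \<and>
        (\<forall>(n::nat) (r::real). n \<ge> 1 \<longrightarrow> r \<ge> r0 \<longrightarrow>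
           1 / K * exp (- (r\<^sup>2) / 2)
             \<le> measure (completion M) (running_sup_ge M B (real n) (r * sqrt (real n))) \<and>
           measure (completion M) (running_sup_ge M B (real n) (r * sqrt (real n)))
             \<le> K * exp (- (r\<^sup>2) / 2)))"
proof -
  interpret planar_standard_brownian_motion M B by fact
  have tail: "prob {\<omega> \<in> space M. r * sqrt (real n) \<le> norm (B (real n) \<omega>)} = exp (- (r\<^sup>2) / 2)"
    if "n \<ge> 1" "r \<ge> 0" for n :: nat and r :: real
    using that by (subst prob_norm_ge) (auto simp: power_mult_distrib)
  \<comment> \<open>The upper constant is Levy's factor 2. The lower bound holds with constant 1 and
    is weakened to 1/2 so that \<open>K = 2\<close> serves both sides; the tail formula covers all
    \<open>r \<ge> 0\<close>, hence \<open>r0 = 0\<close>.\<close>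
  have "1 / 2 * exp (- (r\<^sup>2) / 2)
          \<le> measure (completion M) (running_sup_ge M B (real n) (r * sqrt (real n)))"
       "measure (completion M) (running_sup_ge M B (real n) (r * sqrt (real n)))
          \<le> 2 * exp (- (r\<^sup>2) / 2)"
    if "n \<ge> 1" "r \<ge> 0" for n :: nat and r :: real
    using prob_running_sup_ge_ge[of "real n" "r * sqrt (real n)"]
      prob_running_sup_ge_le[of "real n" "r * sqrt (real n)"] tail[OF that] that by auto
  with tail show ?thesis
    by (intro conjI exI[where x="2::real"] exI[where x="0::real"]) simp_all
qed

end
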